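(* Let $\succeq$ be a binary relation on $\mathbb{R}^n$ and let $f:\mathbb{R}^n\times\mathbb{R}^n\to\mathbb{R}$ and $L>0$ be such that the following hold: (1) $\succeq$ is convex$^s$; (2a) for all $x,y\in\mathbb{R}^n$, $f(x,y)<0$ if and only if $y\in U^s(x)$; (2b) for all $x,y\in\mathbb{R}^n$, $f(x,y)>0$ if and only if $x\in U^s(y)$; (2c) $|f(x,y)|\le L\|x-y\|$ for all $x,y\in\mathbb{R}^n$; (2d) for all $x,y\in\mathbb{R}^n$, the following three statements are equivalent: $x\succ y$; $f(x,z)>f(y,z)$ for all $z\in\mathbb{R}^n$; $f(x,z)>f(y,z)$ for some $z\in\mathbb{R}^n$; (2e) $f$ is upper semicontinuous with respect to its first variable; (3) $\mathscr{ME}_{\succeq}(\mathbb{R}^n)\neq\emptyset$. Let $x_1\in\mathbb{R}^n$ be arbitrary, let $(\theta_k)_{k\ge1}$ be positive real numbers with $\sum_k\theta_k=\infty$ and $\sum_k\theta_k^2<\infty$, and let $(x_k)_{k\ge 1}$ be generated by $$x_{k+1}=x_k-\theta_k x_k^*,\qquad k\in\mathbb{N},$$ where for each $k$, $x_k^*\in N_f(x_k)$ and $\|x_k^*\|\le L$. Assume that $x_k^*\neq 0$ for all $k\in\mathbb{N}$. Then the sequence $(x_k)$ converges to a point $\hat x\in\mathscr{ME}_{\succeq}(\mathbb{R}^n)$.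
   Context: The asymmetric part of $\succeq$: $x\succ y$ means $x\succeq y$ and not $y\succeq x$. Put $U^s(x)=\{y\in\mathbb{R}^n : y\succ x\}$; $\succeq$ is convex$^s$ if $U^s(x)$ is convex for every $x\in\mathbb{R}^n$. The set of maximal elements is $\mathscr{ME}_{\succeq}(\mathbb{R}^n)=\{x\in\mathbb{R}^n : U^s(x)=\emptyset\}$. The Plastria-like normal cone associated to $\succeq$ with respect to $f$ is $N_f(x)=\{x^*\in\mathbb{R}^n : \langle x^*,y-x\rangle\le f(x,y)\ \text{for all } y\in U^s(x)\}$ if $x\notin\mathscr{ME}_{\succeq}(\mathbb{R}^n)$, and $N_f(x)=\mathbb{R}^n$ if $x\in\mathscr{ME}_{\succeq}(\mathbb{R}^n)$.
   Formalization: The formal theorem additionally assumes that no iterate x_k is a maximal element; without this the claim fails, e.g. on R with all points indifferent, f=0, L=1, θ_k=1/k, x_k^*=1, where x_k diverges. *)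

theory Defs
  imports "HOL-Analysis.Analysis"
begin

text \<open>A binary relation on \<open>\<real>\<^sup>n\<close> is a predicate \<open>R\<close>, with \<open>R x y\<close> for "x is weakly preferred to y".
  No order axioms are imposed on it.\<close>

definition strict_part :: "('a \<Rightarrow> 'a \<Rightarrow> bool) \<Rightarrow> 'a \<Rightarrow> 'a \<Rightarrow> bool" where
  "strict_part R x y \<longleftrightarrow> R x y \<and> \<not> R y x"

definition upper_strict :: "('a \<Rightarrow> 'a \<Rightarrow> bool) \<Rightarrow> 'a \<Rightarrow> 'a set" where
  "upper_strict R x = {y. strict_part R y x}"

definition convex_strict :: "(real^'n \<Rightarrow> real^'n \<Rightarrow> bool) \<Rightarrow> bool" where
  "convex_strict R \<longleftrightarrow> (\<forall>x. convex (upper_strict R x))"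

definition maximal_elements :: "('a \<Rightarrow> 'a \<Rightarrow> bool) \<Rightarrow> 'a set" where
  "maximal_elements R = {x. upper_strict R x = {}}"

text \<open>The cone is the whole space at a maximal element, so it puts no constraint on a
  subgradient-type step taken from there: for \<open>R = (\<lambda>x y. True)\<close> and \<open>f = (\<lambda>x y. 0)\<close> every point is
  maximal and every sequence of steps, convergent or not, is admissible. The iteration is
  therefore meant to stop once a maximal element is reached, and a statement about infinitely
  many steps has to assume that the iterates are not maximal. If \<open>f x y < 0\<close> for all \<open>y\<close> in
  \<open>upper_strict R x\<close>, then \<open>x\<close> is maximal exactly if \<open>0\<close> lies in the cone at \<open>x\<close>.\<close>

definition plastria_normal_cone ::
    "(real^'n \<Rightarrow> real^'n \<Rightarrow> bool) \<Rightarrow> (real^'n \<Rightarrow> real^'n \<Rightarrow> real) \<Rightarrow> real^'n \<Rightarrow> (real^'n) set" where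
  "plastria_normal_cone R f x =
     (if x \<in> maximal_elements R then UNIV
      else {v. \<forall>y\<in>upper_strict R x. v \<bullet> (y - x) \<le> f x y})"

definition upper_semicontinuous :: "('a::topological_space \<Rightarrow> real) \<Rightarrow> bool" where
  "upper_semicontinuous g \<longleftrightarrow> (\<forall>x c. g x < c \<longrightarrow> (\<forall>\<^sub>F y in nhds x. g y < c))"

end

theory Submission
  imports Defs
begin

text \<open>For a maximal element \<open>m\<close> the order axioms on \<open>f\<close> give \<open>f (x k) m < 0\<close>, and the cone condition
  turns this into \<open>\<parallel>x (k + 1) - m\<parallel>\<^sup>2 \<le> \<parallel>x k - m\<parallel>\<^sup>2 + 2 \<theta> k f (x k) m + L\<^sup>2 (\<theta> k)\<^sup>2\<close>. Hence the sequence
  is quasi-Fejer monotone with respect to the maximal elements, so it is bounded, and as the sum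
  of the steps diverges, \<open>f (x k) m\<close> tends to 0 along a subsequence. By upper semicontinuity a
  cluster point \<open>c\<close> of that subsequence satisfies \<open>f c m \<ge> 0\<close>, which makes \<open>c\<close> maximal; quasi-Fejer
  monotonicity with respect to \<open>c\<close> itself then yields convergence of the whole sequence.\<close>

lemma quasi_decreasing_bounded:
  fixes d s :: "nat \<Rightarrow> real"
  assumes step: "\<And>k. d (Suc k) \<le> d k + s k"
    and s_nonneg: "\<And>k. s k \<ge> 0" and s_summable: "summable s"
  shows "d n \<le> d 0 + suminf s"
proof -
  have "d n \<le> d 0 + (\<Sum>k<n. s k)"
  proof (induction n)
    case (Suc n)
    then show ?case using step[of n] by simp
  qed simp
  also have "(\<Sum>k<n. s k) \<le> suminf s"
    using s_summable s_nonneg by (intro sum_le_suminf) auto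
  finally show ?thesis by simp
qed

text \<open>Adding the tail of the series of \<open>s\<close> to \<open>d\<close> absorbs the
  permitted increases: the sum is decreasing and bounded below, hence convergent. The tail vanishes,
  so \<open>d\<close> has the same limit, which the subsequence identifies as 0.\<close>

lemma quasi_decreasing_subseq_tendsto_0:
  fixes d s :: "nat \<Rightarrow> real"
  assumes step: "\<And>k. d (Suc k) \<le> d k + s k"
    and d_nonneg: "\<And>k. d k \<ge> 0" and s_summable: "summable s"
    and r: "strict_mono r" and sub: "(d \<circ> r) \<longlonglongrightarrow> 0"
  shows "d \<longlonglongrightarrow> 0"
proof -
  define T where "T n = suminf s - (\<Sum>k<n. s k)" for n
  define E where "E n = d n + T n" for n
  have T: "T \<longlonglongrightarrow> 0"
    using tendsto_diff[OF tendsto_const summable_LIMSEQ[OF s_summable], of "suminf s"]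
    by (simp add: T_def[abs_def])
  have "decseq E"
    unfolding decseq_Suc_iff E_def T_def using step by (simp add: algebra_simps)
  \<comment> \<open>\<open>s\<close> may change sign here, so the tail \<open>T\<close> need not be
    nonnegative; being convergent, it is at least bounded below.\<close>
  moreover obtain B where "\<And>n. B \<le> T n"
    using convergent_imp_Bseq[OF convergentI[OF T]] unfolding Bseq_def
    by (metis abs_le_iff minus_le_iff real_norm_def)
  then have "\<And>n. B \<le> E n"
    using d_nonneg by (simp add: E_def add_increasing)
  ultimately obtain l where l: "E \<longlonglongrightarrow> l"
    by (metis decseq_convergent)
  have "(E \<circ> r) \<longlonglongrightarrow> 0"
    using tendsto_add[OF sub LIMSEQ_subseq_LIMSEQ[OF T r]] by (simp add: E_def o_def)
  with LIMSEQ_subseq_LIMSEQ[OF l r] have "l = 0"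
    by (metis LIMSEQ_unique)
  with tendsto_diff[OF l T] show ?thesis
    by (simp add: E_def)
qed

text \<open>If \<open>a k\<close> stayed above \<open>e\<close> from \<open>N\<close> on,
  telescoping the recursion would bound \<open>e\<close> times every partial sum of the shifted
  \<open>t\<close> by \<open>d N\<close> plus the sum of the shifted \<open>s\<close>, making
  \<open>t\<close> summable.\<close>

lemma nonsummable_weights_small_term:
  fixes d s t a :: "nat \<Rightarrow> real"
  assumes step: "\<And>k. d (Suc k) \<le> d k - t k * a k + s k"
    and d_nonneg: "\<And>k. d k \<ge> 0"
    and s_nonneg: "\<And>k. s k \<ge> 0" and s_summable: "summable s"
    and t_nonneg: "\<And>k. t k \<ge> 0" and t_sum: "\<not> summable t"
    and e: "e > 0"
  shows "\<exists>k\<ge>N. a k < e"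
proof (rule ccontr)
  assume "\<not> ?thesis"
  then have a: "e \<le> a k" if "k \<ge> N" for k
    using that by force
  have s': "summable (\<lambda>k. s (k + N))"
    using s_summable by (simp add: summable_iff_shift)
  have le: "(\<Sum>k<n. t (k + N) * e) \<le> d N - d (n + N) + (\<Sum>k<n. s (k + N))" for n
  proof (induction n)
    case (Suc n)
    have "t (n + N) * e \<le> t (n + N) * a (n + N)"
      by (intro mult_left_mono a t_nonneg) simp
    then show ?case using Suc step[of "n + N"] by simp
  qed simp
  have "(\<Sum>k<n. t (k + N) * e) \<le> d N + (\<Sum>k. s (k + N))" for n
  proof -
    have "(\<Sum>k<n. s (k + N)) \<le> (\<Sum>k. s (k + N))"
      using s' s_nonneg by (intro sum_le_suminf) auto
    then show ?thesis using le[of n] d_nonneg[of "n + N"] by linarith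
  qed
  then have "summable (\<lambda>k. t (k + N) * e)"
    using t_nonneg e by (intro summableI_nonneg_bounded) auto
  then have "summable (\<lambda>k. t (k + N))"
    using e summable_mult2[of _ "1 / e"] by fastforce
  then show False
    using t_sum by (simp add: summable_iff_shift)
qed

theorem theorem4p8:
  fixes R :: "real^'n \<Rightarrow> real^'n \<Rightarrow> bool"
    and f :: "real^'n \<Rightarrow> real^'n \<Rightarrow> real"
    and L :: real
    and \<theta> :: "nat \<Rightarrow> real"
    and x xs :: "nat \<Rightarrow> real^'n"
  assumes L_pos: "L > 0"
    and convex: "convex_strict R"
    and f_neg_iff: "\<And>x y. f x y < 0 \<longleftrightarrow> y \<in> upper_strict R x"
    and f_pos_iff: "\<And>x y. f x y > 0 \<longleftrightarrow> x \<in> upper_strict R y"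
    and f_bound: "\<And>x y. \<bar>f x y\<bar> \<le> L * norm (x - y)"
    and f_all: "\<And>x y. strict_part R x y \<longleftrightarrow> (\<forall>z. f x z > f y z)"
    and f_some: "\<And>x y. strict_part R x y \<longleftrightarrow> (\<exists>z. f x z > f y z)"
    and f_usc: "\<And>y. upper_semicontinuous (\<lambda>x. f x y)"
    and max_nonempty: "maximal_elements R \<noteq> {}"
    and \<theta>_pos: "\<And>k. k \<ge> 1 \<Longrightarrow> \<theta> k > 0"
    and \<theta>_sum: "filterlim (\<lambda>N. \<Sum>k=1..N. \<theta> k) at_top sequentially"
    and \<theta>_sq_sum: "summable (\<lambda>k. (\<theta> (Suc k))\<^sup>2)"
    and step: "\<And>k. k \<ge> 1 \<Longrightarrow> x (Suc k) = x k - \<theta> k *\<^sub>R xs k"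
    and xs_normal: "\<And>k. k \<ge> 1 \<Longrightarrow> xs k \<in> plastria_normal_cone R f (x k)"
    and xs_bound: "\<And>k. k \<ge> 1 \<Longrightarrow> norm (xs k) \<le> L"
    and xs_nonzero: "\<And>k. k \<ge> 1 \<Longrightarrow> xs k \<noteq> 0"
    and nonterminating: "\<And>k. k \<ge> 1 \<Longrightarrow> x k \<notin> maximal_elements R"
  shows "\<exists>xhat \<in> maximal_elements R. x \<longlonglongrightarrow> xhat"
proof -
  \<comment> \<open>The iteration starts at index 1 and \<open>x 0\<close> is unconstrained; the
    shift gives sequences whose hypotheses hold from index 0.\<close>
  define y where "y k = x (Suc k)" for k
  define v where "v k = xs (Suc k)" for k
  define t where "t k = \<theta> (Suc k)" for k
  define s where "s k = L\<^sup>2 * (t k)\<^sup>2" for k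
  have t_pos: "t k > 0" for k
    by (simp add: t_def \<theta>_pos)
  have s_nonneg: "s k \<ge> 0" for k
    by (simp add: s_def)
  have s_summable: "summable s"
    unfolding s_def t_def by (intro summable_mult \<theta>_sq_sum)
  have t_sum: "\<not> summable t"
  proof
    assume "summable t"
    then have "(\<lambda>N. \<Sum>k=1..N. \<theta> k) \<longlonglongrightarrow> suminf t"
      using summable_LIMSEQ[of t] by (simp add: sum.atLeast1_atMost_eq t_def)
    then show False
      using not_tendsto_and_filterlim_at_infinity filterlim_at_top_imp_at_infinity[OF \<theta>_sum]
        trivial_limit_sequentially by blast
  qed
  have le_max: "f w m \<le> 0" if "m \<in> maximal_elements R" for w m
    using that f_pos_iff[of w m] by (auto simp: maximal_elements_def not_less[symmetric])
  \<comment> \<open>Some \<open>w\<close> is strictly preferred to the nonmaximal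
    \<open>y k\<close>, and \<open>f\<close> strictly increases in its first argument along strict
    preference, so \<open>f (y k) m\<close> lies strictly below \<open>f w m\<close>, which is at
    most 0.\<close>
  have neg: "f (y k) m < 0" if "m \<in> maximal_elements R" for k m
  proof -
    obtain w where "strict_part R w (y k)"
      using nonterminating[of "Suc k"] by (auto simp: maximal_elements_def upper_strict_def y_def)
    then have "f (y k) m < f w m"
      using f_all by blast
    with le_max[OF that, of w] show ?thesis
      by linarith
  qed
  have fejer: "(norm (y (Suc k) - m))\<^sup>2 \<le> (norm (y k - m))\<^sup>2 - t k * (- 2 * f (y k) m) + s k"
    if m: "m \<in> maximal_elements R" for k m
  proof -
    \<comment> \<open>Nonmaximality of \<open>y k\<close> selects the nontrivial branch of the cone,
      and \<open>neg\<close> places \<open>m\<close> in the strict upper set, so its inequality may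
      be tested at \<open>m\<close>.\<close>
    have "v k \<bullet> (m - y k) \<le> f (y k) m"
      using xs_normal[of "Suc k"] nonterminating[of "Suc k"] neg[OF m, of k] f_neg_iff
      by (simp add: plastria_normal_cone_def v_def y_def)
    then have cone: "t k * (v k \<bullet> (m - y k)) \<le> t k * f (y k) m"
      using t_pos[of k] by (intro mult_left_mono) auto
    have "norm (v k) \<le> L"
      using xs_bound[of "Suc k"] by (simp add: v_def)
    then have "(norm (v k))\<^sup>2 * (t k)\<^sup>2 \<le> s k"
      unfolding s_def by (intro mult_right_mono power_mono) auto
    moreover have "y (Suc k) - m = (y k - m) - t k *\<^sub>R v k"
      using step[of "Suc k"] by (simp add: y_def v_def t_def)
    then have "(norm (y (Suc k) - m))\<^sup>2 =
        (norm (y k - m))\<^sup>2 + 2 * (t k * (v k \<bullet> (m - y k))) + (norm (v k))\<^sup>2 * (t k)\<^sup>2"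
      by (simp only: power2_norm_eq_inner)
        (simp add: inner_diff_left inner_diff_right inner_commute algebra_simps power2_eq_square)
    ultimately show ?thesis
      using cone by linarith
  qed
  have quasi: "(norm (y (Suc k) - m))\<^sup>2 \<le> (norm (y k - m))\<^sup>2 + s k"
    if "m \<in> maximal_elements R" for k m
    using fejer[OF that, of k] mult_pos_neg[OF t_pos neg[OF that], of k k] by linarith
  obtain m where m: "m \<in> maximal_elements R"
    using max_nonempty by blast
  \<comment> \<open>In \<open>fejer\<close>, \<open>- 2 * f (y k) m\<close> is the positive gap
    weighted by the nonsummable steps, so it becomes arbitrarily small at arbitrarily late
    indices.\<close>
  have small: "\<exists>k\<ge>N. - 2 * f (y k) m < e" if "e > 0" for N e
    using nonsummable_weights_small_term[of "\<lambda>k. (norm (y k - m))\<^sup>2" t "\<lambda>k. - 2 * f (y k) m" s e N]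
      fejer[OF m] s_nonneg s_summable t_pos t_sum that by (simp add: less_imp_le)
  have "\<exists>r. \<forall>n. - 2 * f (y (r n)) m < 1 / real (Suc n) \<and> r n < r (Suc n)"
  proof (rule dependent_nat_choice
      [where P = "\<lambda>n k. - 2 * f (y k) m < 1 / real (Suc n)" and Q = "\<lambda>n k j. k < j"])
    show "\<exists>k. - 2 * f (y k) m < 1 / real (Suc 0)"
      using small[of 1 0] by auto
    show "\<exists>j. - 2 * f (y j) m < 1 / real (Suc (Suc n)) \<and> k < j" for k n
      using small[of "1 / real (Suc (Suc n))" "Suc k"] by (auto simp: Suc_le_eq)
  qed
  then obtain r where r: "\<And>n. - 2 * f (y (r n)) m < 1 / real (Suc n)" "strict_mono r"
    by (auto simp: strict_mono_Suc_iff)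
  have "bounded (range (y \<circ> r))"
  proof -
    define B where "B = (norm (y 0 - m))\<^sup>2 + suminf s"
    have "norm (y k - m) \<le> sqrt B" for k
      unfolding B_def
      using quasi_decreasing_bounded[of "\<lambda>k. (norm (y k - m))\<^sup>2", OF quasi[OF m] s_nonneg s_summable]
      by (intro real_le_rsqrt)
    then show ?thesis
      unfolding bounded_def by (auto simp: dist_norm norm_minus_commute)
  qed
  then obtain c q where q: "strict_mono q" and c: "(y \<circ> r \<circ> q) \<longlonglongrightarrow> c"
    using bounded_imp_convergent_subsequence[of "y \<circ> r"] by (auto simp: o_def)
  have "f c m \<ge> 0"
  proof (rule ccontr)
    assume "\<not> f c m \<ge> 0"
    \<comment> \<open>Upper semicontinuity keeps \<open>f\<close> below the negative
      \<open>b\<close> along the subsequence, while the choice of \<open>r\<close> forces these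
      values above a bound tending to 0.\<close>
    then obtain b where b: "f c m < b" "b < 0"
      using dense[of "f c m" 0] by auto
    have "\<forall>\<^sub>F n in sequentially. f (y (r (q n))) m < b"
      using f_usc[of m] b c unfolding upper_semicontinuous_def
      by (auto simp: filterlim_iff o_def)
    moreover have "(\<lambda>n. 1 / real (Suc n)) \<longlonglongrightarrow> 0"
      using LIMSEQ_inverse_real_of_nat by (simp add: inverse_eq_divide)
    from LIMSEQ_subseq_LIMSEQ[OF this q]
    have "\<forall>\<^sub>F n in sequentially. 1 / real (Suc (q n)) < - 2 * b"
      using b by (intro order_tendstoD) (auto simp: o_def)
    ultimately have "\<forall>\<^sub>F n in sequentially. False"
    proof eventually_elim
      case (elim n)
      then show ?case using r(1)[of "q n"] by linarith
    qed
    then show False by simp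
  qed
  have c_max: "c \<in> maximal_elements R"
  proof (rule ccontr)
    assume "c \<notin> maximal_elements R"
    then obtain w where "strict_part R w c"
      by (auto simp: maximal_elements_def upper_strict_def)
    then have "f c m < f w m"
      using f_all by blast
    with \<open>f c m \<ge> 0\<close> le_max[OF m, of w] show False
      by linarith
  qed
  have "((\<lambda>k. (norm (y k - c))\<^sup>2) \<circ> (r \<circ> q)) \<longlonglongrightarrow> 0"
    using tendsto_power[OF tendsto_norm[OF tendsto_diff[OF c tendsto_const[of c]]], of 2]
    by (simp add: o_def)
  \<comment> \<open>Since \<open>c\<close> is itself maximal, \<open>quasi\<close> applies with
    \<open>c\<close> in place of \<open>m\<close> and lifts convergence from the subsequence to all
    of \<open>y\<close>.\<close>
  then have "(\<lambda>k. (norm (y k - c))\<^sup>2) \<longlonglongrightarrow> 0"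
    using quasi_decreasing_subseq_tendsto_0[of "\<lambda>k. (norm (y k - c))\<^sup>2" s "r \<circ> q"]
      quasi[OF c_max] s_summable strict_mono_o[OF r(2) q] by simp
  then have "(\<lambda>k. norm (y k - c)) \<longlonglongrightarrow> 0"
    by (simp add: power_tendsto_0_iff)
  then have "y \<longlonglongrightarrow> c"
    by (simp add: LIM_zero_iff tendsto_norm_zero_iff)
  then have "x \<longlonglongrightarrow> c"
    unfolding y_def by (rule LIMSEQ_imp_Suc)
  with c_max show ?thesis by blast
qed

end
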